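(* Every subgroup of a post-injunctive group is also post-injunctive.
   Context: For a group $G$ and a set $A$ (the alphabet), $A^G$ is the set of all maps $x\colon G\to A$ (configurations), with shift action $(gx)(h)=x(g^{-1}h)$. A cellular automaton $\tau\colon A^G\to A^G$ is a map for which there exist a finite subset $M\subset G$ (a memory set) and a map $\mu\colon A^M\to A$ (the local transition map) such that $\tau(x)(g)=\mu((g^{-1}x)|_M)$ for all $x\in A^G$, $g\in G$. Two configurations $x,y\in A^G$ are asymptotic if $x|_{G\setminus E}=y|_{G\setminus E}$ for some finite $E\subset G$. The cellular automaton $\tau$ is pre-injective if for all asymptotic $x,y\in A^G$, $\tau(x)=\tau(y)$ implies $x=y$. It is post-surjective if for all $x,y\in A^G$ with $y$ asymptotic to $\tau(x)$, there exists $z\in A^G$ asymptotic to $x$ with $\tau(z)=y$. A group $G$ is post-injunctive if for every finite alphabet $A$, every post-surjective cellular automaton $\tau\colon A^G\to A^G$ is pre-injective. *)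

theory Defs
  imports "HOL-Algebra.Coset"
begin

definition configs :: "('g, 'm) monoid_scheme \<Rightarrow> 'a set \<Rightarrow> ('g \<Rightarrow> 'a) set" where
  "configs G A = carrier G \<rightarrow>\<^sub>E A"

definition shift :: "('g, 'm) monoid_scheme \<Rightarrow> 'g \<Rightarrow> ('g \<Rightarrow> 'a) \<Rightarrow> 'g \<Rightarrow> 'a" where
  "shift G g x = (\<lambda>h\<in>carrier G. x (inv\<^bsub>G\<^esub> g \<otimes>\<^bsub>G\<^esub> h))"

text \<open>A map \<open>\<tau>\<close> on configurations is given by a HOL function of which only the values on
  \<^term>\<open>configs G A\<close> matter; likewise only the values of \<open>\<mu>\<close> on patterns over \<open>M\<close> matter.\<close>

definition cellular_automaton ::
  "('g, 'm) monoid_scheme \<Rightarrow> 'a set \<Rightarrow> (('g \<Rightarrow> 'a) \<Rightarrow> ('g \<Rightarrow> 'a)) \<Rightarrow> bool" where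
  "cellular_automaton G A \<tau> \<longleftrightarrow>
     \<tau> \<in> configs G A \<rightarrow> configs G A \<and>
     (\<exists>M \<mu>. finite M \<and> M \<subseteq> carrier G \<and> \<mu> \<in> (M \<rightarrow>\<^sub>E A) \<rightarrow> A \<and>
        (\<forall>x\<in>configs G A. \<forall>g\<in>carrier G. \<tau> x g = \<mu> (restrict (shift G (inv\<^bsub>G\<^esub> g) x) M)))"

definition asymptotic :: "('g, 'm) monoid_scheme \<Rightarrow> ('g \<Rightarrow> 'a) \<Rightarrow> ('g \<Rightarrow> 'a) \<Rightarrow> bool" where
  "asymptotic G x y \<longleftrightarrow>
     (\<exists>E. finite E \<and> E \<subseteq> carrier G \<and> restrict x (carrier G - E) = restrict y (carrier G - E))"

definition pre_injective ::
  "('g, 'm) monoid_scheme \<Rightarrow> 'a set \<Rightarrow> (('g \<Rightarrow> 'a) \<Rightarrow> ('g \<Rightarrow> 'a)) \<Rightarrow> bool" where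
  "pre_injective G A \<tau> \<longleftrightarrow>
     (\<forall>x\<in>configs G A. \<forall>y\<in>configs G A. asymptotic G x y \<longrightarrow> \<tau> x = \<tau> y \<longrightarrow> x = y)"

definition post_surjective ::
  "('g, 'm) monoid_scheme \<Rightarrow> 'a set \<Rightarrow> (('g \<Rightarrow> 'a) \<Rightarrow> ('g \<Rightarrow> 'a)) \<Rightarrow> bool" where
  "post_surjective G A \<tau> \<longleftrightarrow>
     (\<forall>x\<in>configs G A. \<forall>y\<in>configs G A. asymptotic G y (\<tau> x) \<longrightarrow>
        (\<exists>z\<in>configs G A. asymptotic G z x \<and> \<tau> z = y))"

text \<open>HOL cannot quantify over the type of the alphabet inside a definition, so alphabets range
  over finite sets of naturals. Every finite set is in bijection with one of these, and
  \<open>post_injunctive_alphabet\<close> below derives the property for finite alphabets of any type.\<close>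

definition post_injunctive :: "('g, 'm) monoid_scheme \<Rightarrow> bool" where
  "post_injunctive G \<longleftrightarrow>
     (\<forall>(A::nat set) \<tau>. finite A \<longrightarrow> cellular_automaton G A \<tau> \<longrightarrow>
        post_surjective G A \<tau> \<longrightarrow> pre_injective G A \<tau>)"

lemma post_injunctive_alphabet:
  fixes A :: "'a set" and G :: "('g, 'm) monoid_scheme"
  assumes G: "group G" and inj: "post_injunctive G" and fin: "finite A"
    and ca: "cellular_automaton G A \<tau>" and ps: "post_surjective G A \<tau>"
  shows "pre_injective G A \<tau>"
proof -
  interpret group G by (rule G)
  let ?C = "carrier G"
  obtain f :: "'a \<Rightarrow> nat" where f: "inj_on f A"
    using finite_imp_inj_to_nat_seg[OF fin] by blast
  define B where "B = f ` A"
  define k where "k = inv_into A f"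
  have fB: "f a \<in> B" if "a \<in> A" for a using that by (simp add: B_def)
  have kA: "k b \<in> A" if "b \<in> B" for b using that by (simp add: B_def k_def inv_into_into)
  have kf: "k (f a) = a" if "a \<in> A" for a using that f by (simp add: k_def)
  have fk: "f (k b) = b" if "b \<in> B" for b using that by (simp add: B_def k_def f_inv_into_f)
  define F where "F x = (\<lambda>g\<in>?C. f (x g))" for x :: "'g \<Rightarrow> 'a"
  define K where "K x = (\<lambda>g\<in>?C. k (x g))" for x :: "'g \<Rightarrow> nat"
  have FB: "F x \<in> configs G B" if "x \<in> configs G A" for x
    using that fB by (auto simp: F_def configs_def)
  have KA: "K x \<in> configs G A" if "x \<in> configs G B" for x
    using that kA by (auto simp: K_def configs_def)
  have KF: "K (F x) = x" if "x \<in> configs G A" for x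
  proof
    fix g show "K (F x) g = x g"
    proof (cases "g \<in> ?C")
      case True
      then have "x g \<in> A" using that by (auto simp: configs_def)
      with True show ?thesis by (simp add: K_def F_def kf)
    next
      case False
      then show ?thesis using PiE_arb[OF that[unfolded configs_def] False]
        by (simp add: K_def F_def)
    qed
  qed
  have FK: "F (K x) = x" if "x \<in> configs G B" for x
  proof
    fix g show "F (K x) g = x g"
    proof (cases "g \<in> ?C")
      case True
      then have "x g \<in> B" using that by (auto simp: configs_def)
      with True show ?thesis by (simp add: K_def F_def fk)
    next
      case False
      then show ?thesis using PiE_arb[OF that[unfolded configs_def] False]
        by (simp add: K_def F_def)
    qed
  qed
  have asym: "asymptotic G x y \<longleftrightarrow> (\<exists>E. finite E \<and> E \<subseteq> ?C \<and> (\<forall>g\<in>?C - E. x g = y g))"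
    for x y :: "'g \<Rightarrow> 'c"
  proof -
    have "restrict x (?C - E) = restrict y (?C - E) \<longleftrightarrow> (\<forall>g\<in>?C - E. x g = y g)" for E
      by (auto simp only: restrict_def fun_eq_iff split: if_splits)
    then show ?thesis by (simp add: asymptotic_def)
  qed
  have aF: "asymptotic G (F x) (F y)" if "asymptotic G x y" for x y
    using that unfolding asym by (elim exE conjE, intro exI conjI) (assumption+, simp add: F_def)
  have aK: "asymptotic G (K x) (K y)" if "asymptotic G x y" for x y
    using that unfolding asym by (elim exE conjE, intro exI conjI) (assumption+, simp add: K_def)
  define \<sigma> where "\<sigma> x = F (\<tau> (K x))" for x
  have \<tau>: "\<tau> x \<in> configs G A" if "x \<in> configs G A" for x
    using ca that by (auto simp: cellular_automaton_def)
  obtain M \<mu> where M: "finite M" "M \<subseteq> ?C" and \<mu>: "\<mu> \<in> (M \<rightarrow>\<^sub>E A) \<rightarrow> A"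
    and loc: "\<And>x g. x \<in> configs G A \<Longrightarrow> g \<in> ?C \<Longrightarrow>
      \<tau> x g = \<mu> (restrict (shift G (inv\<^bsub>G\<^esub> g) x) M)"
    using ca unfolding cellular_automaton_def by blast
  define \<nu> where "\<nu> p = f (\<mu> (\<lambda>m\<in>M. k (p m)))" for p
  have "cellular_automaton G B \<sigma>"
    unfolding cellular_automaton_def
  proof (intro conjI exI[of _ M] exI[of _ \<nu>] ballI)
    show "\<sigma> \<in> configs G B \<rightarrow> configs G B" using KA FB \<tau> by (auto simp: \<sigma>_def)
    show "\<nu> \<in> (M \<rightarrow>\<^sub>E B) \<rightarrow> B"
    proof
      fix p assume p: "p \<in> M \<rightarrow>\<^sub>E B"
      have "(\<lambda>m\<in>M. k (p m)) \<in> M \<rightarrow>\<^sub>E A" using p kA by auto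
      from fB[OF funcset_mem[OF \<mu> this]] show "\<nu> p \<in> B" by (simp add: \<nu>_def)
    qed
    fix x g assume x: "x \<in> configs G B" and g: "g \<in> ?C"
    have "restrict (shift G (inv\<^bsub>G\<^esub> g) (K x)) M
        = (\<lambda>m\<in>M. k (restrict (shift G (inv\<^bsub>G\<^esub> g) x) M m))"
      (is "?l = ?r")
    proof
      fix m show "?l m = ?r m"
        using M(2) g by (cases "m \<in> M") (auto simp: shift_def K_def subsetD)
    qed
    then show "\<sigma> x g = \<nu> (restrict (shift G (inv\<^bsub>G\<^esub> g) x) M)"
      using loc[OF KA[OF x] g] g by (simp add: \<sigma>_def F_def \<nu>_def)
  qed (use M in auto)
  moreover have "post_surjective G B \<sigma>"
    unfolding post_surjective_def
  proof (intro ballI impI)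
    fix x y assume x: "x \<in> configs G B" and y: "y \<in> configs G B" and a: "asymptotic G y (\<sigma> x)"
    have "asymptotic G (K y) (\<tau> (K x))"
      using aK[OF a] KF[OF \<tau>[OF KA[OF x]]] by (simp add: \<sigma>_def)
    then obtain z where z: "z \<in> configs G A" "asymptotic G z (K x)" "\<tau> z = K y"
      using ps KA[OF x] KA[OF y] unfolding post_surjective_def by blast
    have "asymptotic G (F z) x" using aF[OF z(2)] FK[OF x] by simp
    moreover have "\<sigma> (F z) = y" using KF[OF z(1)] z(3) FK[OF y] by (simp add: \<sigma>_def)
    ultimately show "\<exists>z\<in>configs G B. asymptotic G z x \<and> \<sigma> z = y" using FB[OF z(1)] by blast
  qed
  moreover have "finite B" using fin by (simp add: B_def)
  ultimately have pi: "pre_injective G B \<sigma>" using inj unfolding post_injunctive_def by blast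
  show ?thesis
    unfolding pre_injective_def
  proof (intro ballI impI)
    fix x y assume x: "x \<in> configs G A" and y: "y \<in> configs G A"
      and a: "asymptotic G x y" and e: "\<tau> x = \<tau> y"
    have "\<sigma> (F x) = \<sigma> (F y)" using KF[OF x] KF[OF y] e by (simp add: \<sigma>_def)
    then have "F x = F y"
      using pi FB[OF x] FB[OF y] aF[OF a] unfolding pre_injective_def by blast
    then show "x = y" using KF[OF x] KF[OF y] by metis
  qed
qed

end

theory Submission
  imports Defs
begin

text \<open>A cellular automaton over \<open>H\<close> with memory set \<open>M\<close> and local map \<open>\<mu>\<close> induces one over \<open>G\<close> with
  the same \<open>M\<close> and \<open>\<mu>\<close>. As \<open>M \<subseteq> H\<close>, the induced automaton acts on each left coset of \<open>H\<close> separately,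
  as a copy of the original one. Post-surjectivity passes to the induced automaton because an
  asymptotic perturbation meets finitely many cosets, and on all others nothing has to be changed.
  Pre-injectivity passes back by extending two configurations on \<open>H\<close> by a common constant.\<close>

text \<open>The shift is unfolded: \<open>x (g \<otimes> m)\<close> is the value at \<open>m\<close>
  of \<open>x\<close> shifted by the inverse of \<open>g\<close>. The group enters only through its
  product and the domain of the result, so the same \<open>M\<close> and \<open>\<mu>\<close> serve
  for \<open>H\<close> and for \<open>G\<close>.\<close>

definition local_ca ::
  "('g, 'm) monoid_scheme \<Rightarrow> 'g set \<Rightarrow> (('g \<Rightarrow> 'a) \<Rightarrow> 'a) \<Rightarrow> ('g \<Rightarrow> 'a) \<Rightarrow> 'g \<Rightarrow> 'a" where
  "local_ca G M \<mu> x = (\<lambda>g\<in>carrier G. \<mu> (\<lambda>m\<in>M. x (g \<otimes>\<^bsub>G\<^esub> m)))"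

text \<open>This is \<open>x\<close> on the left coset of \<open>t\<close>, carried back to
  \<open>H\<close> by left translation.\<close>

definition slice :: "('g, 'm) monoid_scheme \<Rightarrow> 'g set \<Rightarrow> 'g \<Rightarrow> ('g \<Rightarrow> 'a) \<Rightarrow> 'g \<Rightarrow> 'a" where
  "slice G H t x = (\<lambda>h\<in>H. x (t \<otimes>\<^bsub>G\<^esub> h))"

text \<open>The set of disagreement is the least possible exceptional set, so the existential over
  \<open>E\<close> becomes a finiteness statement.\<close>

lemma asymptotic_iff: "asymptotic G x y \<longleftrightarrow> finite {g \<in> carrier G. x g \<noteq> y g}"
proof
  assume "asymptotic G x y"
  then obtain E where E: "finite E"
    and eq: "restrict x (carrier G - E) = restrict y (carrier G - E)"
    unfolding asymptotic_def by blast
  have "{g \<in> carrier G. x g \<noteq> y g} \<subseteq> E"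
    using eq by (auto simp: restrict_def fun_eq_iff split: if_splits)
  then show "finite {g \<in> carrier G. x g \<noteq> y g}" using E finite_subset by blast
next
  assume fin: "finite {g \<in> carrier G. x g \<noteq> y g}"
  show "asymptotic G x y"
    unfolding asymptotic_def
    by (rule exI[of _ "{g \<in> carrier G. x g \<noteq> y g}"]) (use fin in \<open>auto simp: restrict_def\<close>)
qed

lemma local_ca_in_configs:
  assumes "group G" "M \<subseteq> carrier G" "\<mu> \<in> (M \<rightarrow>\<^sub>E A) \<rightarrow> A" "x \<in> configs G A"
  shows "local_ca G M \<mu> x \<in> configs G A"
proof -
  interpret group G by fact
  have "(\<lambda>m\<in>M. x (g \<otimes>\<^bsub>G\<^esub> m)) \<in> M \<rightarrow>\<^sub>E A" if "g \<in> carrier G" for g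
    using assms(2,4) that by (auto simp: configs_def)
  then have "\<mu> (\<lambda>m\<in>M. x (g \<otimes>\<^bsub>G\<^esub> m)) \<in> A" if "g \<in> carrier G" for g
    using that by (intro funcset_mem[OF assms(3)])
  then show ?thesis
    by (auto simp: configs_def local_ca_def)
qed

text \<open>This replaces pointwise conditions with shifts by an equality of functions. Values
  outside the carrier cause no trouble, since both sides are extensional.\<close>

lemma cellular_automaton_iff_local_ca:
  assumes "group G"
  shows "cellular_automaton G A \<tau> \<longleftrightarrow>
    (\<exists>M \<mu>. finite M \<and> M \<subseteq> carrier G \<and> \<mu> \<in> (M \<rightarrow>\<^sub>E A) \<rightarrow> A \<and>
      (\<forall>x\<in>configs G A. \<tau> x = local_ca G M \<mu> x))"
proof -
  interpret group G by fact
  have shift: "restrict (shift G (inv\<^bsub>G\<^esub> g) x) M = (\<lambda>m\<in>M. x (g \<otimes>\<^bsub>G\<^esub> m))"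
    if "g \<in> carrier G" "M \<subseteq> carrier G" for g M and x :: "'a \<Rightarrow> 'c"
    using that by (auto simp: shift_def fun_eq_iff)
  show ?thesis
  proof
    assume ca: "cellular_automaton G A \<tau>"
    then obtain M \<mu> where M: "finite M" "M \<subseteq> carrier G" "\<mu> \<in> (M \<rightarrow>\<^sub>E A) \<rightarrow> A"
      and loc: "\<And>x g. x \<in> configs G A \<Longrightarrow> g \<in> carrier G \<Longrightarrow>
        \<tau> x g = \<mu> (restrict (shift G (inv\<^bsub>G\<^esub> g) x) M)"
      unfolding cellular_automaton_def by blast
    have "\<tau> x = local_ca G M \<mu> x" if x: "x \<in> configs G A" for x
    proof (rule extensionalityI)
      show "\<tau> x \<in> extensional (carrier G)"
        using ca x by (auto simp: cellular_automaton_def configs_def PiE_def)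
      show "local_ca G M \<mu> x \<in> extensional (carrier G)" by (simp add: local_ca_def)
      show "\<tau> x g = local_ca G M \<mu> x g" if "g \<in> carrier G" for g
        using loc[OF x that] shift[OF that M(2)] that by (simp add: local_ca_def)
    qed
    with M show "\<exists>M \<mu>. finite M \<and> M \<subseteq> carrier G \<and> \<mu> \<in> (M \<rightarrow>\<^sub>E A) \<rightarrow> A \<and>
      (\<forall>x\<in>configs G A. \<tau> x = local_ca G M \<mu> x)" by blast
  next
    assume "\<exists>M \<mu>. finite M \<and> M \<subseteq> carrier G \<and> \<mu> \<in> (M \<rightarrow>\<^sub>E A) \<rightarrow> A \<and>
      (\<forall>x\<in>configs G A. \<tau> x = local_ca G M \<mu> x)"
    then obtain M \<mu> where M: "finite M" "M \<subseteq> carrier G" "\<mu> \<in> (M \<rightarrow>\<^sub>E A) \<rightarrow> A"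
      and \<tau>: "\<And>x. x \<in> configs G A \<Longrightarrow> \<tau> x = local_ca G M \<mu> x"
      by blast
    have "\<tau> \<in> configs G A \<rightarrow> configs G A"
      using \<tau> local_ca_in_configs[OF assms M(2,3)] by auto
    moreover have "\<tau> x g = \<mu> (restrict (shift G (inv\<^bsub>G\<^esub> g) x) M)"
      if "x \<in> configs G A" "g \<in> carrier G" for x g
      using \<tau> shift[OF that(2) M(2)] that by (simp add: local_ca_def)
    ultimately show "cellular_automaton G A \<tau>"
      unfolding cellular_automaton_def using M by blast
  qed
qed

text \<open>By associativity the neighbour \<open>t \<otimes> h \<otimes> m\<close> is
  \<open>t \<otimes> (h \<otimes> m)\<close>, and \<open>h \<otimes> m\<close> stays in
  \<open>H\<close> because \<open>M\<close> lies in \<open>H\<close>. So each coset evolves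
  independently of the others.\<close>

lemma (in group) slice_local_ca:
  assumes H: "subgroup H G" and M: "M \<subseteq> H" and t: "t \<in> carrier G"
  shows "slice G H t (local_ca G M \<mu> x) = local_ca (G\<lparr>carrier := H\<rparr>) M \<mu> (slice G H t x)"
proof -
  have "(\<lambda>m\<in>M. x (t \<otimes> h \<otimes> m)) = (\<lambda>m\<in>M. slice G H t x (h \<otimes> m))" if "h \<in> H" for h
    using that M t subgroup.mem_carrier[OF H] subgroup.m_closed[OF H]
    by (auto simp: slice_def m_assoc fun_eq_iff subset_iff)
  with t subgroup.mem_carrier[OF H] show ?thesis
    unfolding slice_def[of G H t "local_ca G M \<mu> x"]
    by (simp add: local_ca_def cong: restrict_cong)
qed

lemma (in group) slice_in_configs:
  assumes "subgroup H G" "t \<in> carrier G" "x \<in> configs G A"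
  shows "slice G H t x \<in> configs (G\<lparr>carrier := H\<rparr>) A"
  using assms subgroup.mem_carrier[OF assms(1)] by (auto simp: slice_def configs_def)

lemma (in group) obtain_coset_representatives:
  assumes "subgroup H G"
  obtains r where "\<And>g. g \<in> carrier G \<Longrightarrow> r g \<in> carrier G"
    and "\<And>g. g \<in> carrier G \<Longrightarrow> inv (r g) \<otimes> g \<in> H"
    and "\<And>g h. g \<in> carrier G \<Longrightarrow> h \<in> H \<Longrightarrow> r (r g \<otimes> h) = r g"
proof -
  interpret H: subgroup H G by fact
  \<comment> \<open>The choice depends on \<open>g\<close> only through its coset, so equal cosets
    receive the same representative.\<close>
  define r where "r g = (SOME t. t \<in> g <# H)" for g
  have r: "r g \<in> g <# H" if "g \<in> carrier G" for g
    unfolding r_def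
  proof (rule someI[of _ g])
    show "g \<in> g <# H" using that H.one_closed by (force simp: l_coset_def)
  qed
  have carr: "r g \<in> carrier G" if "g \<in> carrier G" for g
    using r[OF that] that by (auto simp: l_coset_def)
  have inH: "inv (r g) \<otimes> g \<in> H" if g: "g \<in> carrier G" for g
  proof -
    obtain h where h: "h \<in> H" "r g = g \<otimes> h" using r[OF g] by (auto simp: l_coset_def)
    then have "inv (r g) \<otimes> g = inv h" using g by (simp add: inv_mult_group m_assoc)
    then show ?thesis using h by simp
  qed
  have coset: "r g \<otimes> h <# H = g <# H" if g: "g \<in> carrier G" and h: "h \<in> H" for g h
  proof -
    have "r g \<otimes> h \<in> g <# H"
      using r[OF g] g h by (auto simp: l_coset_def m_assoc)
    then show ?thesis using l_repr_independence[OF _ g assms] by simp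
  qed
  then have "r (r g \<otimes> h) = r g" if "g \<in> carrier G" "h \<in> H" for g h
    using that by (simp add: r_def[of "r g \<otimes> h"]) (simp add: r_def)
  with carr inH that show thesis by blast
qed

lemma (in group) post_surjective_induced:
  assumes H: "subgroup H G" and M: "M \<subseteq> H"
    and \<mu>: "\<mu> \<in> (M \<rightarrow>\<^sub>E A) \<rightarrow> A"
    and ps: "post_surjective (G\<lparr>carrier := H\<rparr>) A (local_ca (G\<lparr>carrier := H\<rparr>) M \<mu>)"
  shows "post_surjective G A (local_ca G M \<mu>)"
  unfolding post_surjective_def
proof (intro ballI impI)
  let ?K = "G\<lparr>carrier := H\<rparr>"
  let ?\<tau> = "local_ca ?K M \<mu>" and ?\<sigma> = "local_ca G M \<mu>"
  interpret H: subgroup H G by fact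
  fix x y assume x: "x \<in> configs G A" and y: "y \<in> configs G A" and "asymptotic G y (?\<sigma> x)"
  then have fin: "finite {g \<in> carrier G. y g \<noteq> ?\<sigma> x g}" by (simp add: asymptotic_iff)
  obtain r where r: "\<And>g. g \<in> carrier G \<Longrightarrow> r g \<in> carrier G"
    and rH: "\<And>g. g \<in> carrier G \<Longrightarrow> inv (r g) \<otimes> g \<in> H"
    and rr: "\<And>g h. g \<in> carrier G \<Longrightarrow> h \<in> H \<Longrightarrow> r (r g \<otimes> h) = r g"
    using obtain_coset_representatives[OF H] by metis
  have split: "r g \<otimes> (inv (r g) \<otimes> g) = g" if "g \<in> carrier G" for g
    using r[OF that] that by (simp flip: m_assoc)
  \<comment> \<open>The last conjunct forces the preimage to be the slice of \<open>x\<close> itself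
    wherever no correction is required. Otherwise the choices could change \<open>x\<close> on
    infinitely many cosets.\<close>
  have "\<exists>z\<in>configs ?K A. asymptotic ?K z (slice G H t x) \<and> ?\<tau> z = slice G H t y \<and>
      (slice G H t y = ?\<tau> (slice G H t x) \<longrightarrow> z = slice G H t x)" if t: "t \<in> carrier G" for t
  proof (cases "slice G H t y = ?\<tau> (slice G H t x)")
    case True
    then show ?thesis
      by (intro bexI[of _ "slice G H t x"])
        (auto simp: asymptotic_iff slice_in_configs[OF H t x])
  next
    case False
    \<comment> \<open>Left translation by \<open>t\<close> embeds the disagreements of the slices
      into the finite set of \<open>fin\<close>.\<close>
    have "(\<lambda>h. t \<otimes> h) ` {h \<in> H. slice G H t y h \<noteq> slice G H t (?\<sigma> x) h}
        \<subseteq> {g \<in> carrier G. y g \<noteq> ?\<sigma> x g}"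
      using t by (auto simp: slice_def)
    moreover have "inj_on (\<lambda>h. t \<otimes> h) {h \<in> H. slice G H t y h \<noteq> slice G H t (?\<sigma> x) h}"
      using t by (auto simp: inj_on_def)
    ultimately have "asymptotic ?K (slice G H t y) (slice G H t (?\<sigma> x))"
      using fin by (simp add: asymptotic_iff inj_on_finite)
    then have "asymptotic ?K (slice G H t y) (?\<tau> (slice G H t x))"
      by (simp add: slice_local_ca[OF H M t])
    with False ps show ?thesis
      using slice_in_configs[OF H t x] slice_in_configs[OF H t y]
      unfolding post_surjective_def by blast
  qed
  then obtain Z where Z: "\<And>t. t \<in> carrier G \<Longrightarrow> Z t \<in> configs ?K A"
    and Zx: "\<And>t. t \<in> carrier G \<Longrightarrow> asymptotic ?K (Z t) (slice G H t x)"
    and \<tau>Z: "\<And>t. t \<in> carrier G \<Longrightarrow> ?\<tau> (Z t) = slice G H t y"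
    and Zeq: "\<And>t. t \<in> carrier G \<Longrightarrow> slice G H t y = ?\<tau> (slice G H t x) \<Longrightarrow> Z t = slice G H t x"
    by metis
  \<comment> \<open>The local preimages are glued. Only those at representatives are used, so each
    coset is filled from a single \<open>Z t\<close>.\<close>
  define z where "z = (\<lambda>g\<in>carrier G. Z (r g) (inv (r g) \<otimes> g))"
  have zc: "z \<in> configs G A"
    using Z[OF r] rH by (auto simp: z_def configs_def)
  have slice_z: "slice G H (r g) z = Z (r g)" if g: "g \<in> carrier G" for g
  proof (rule extensionalityI[of _ H])
    show "Z (r g) \<in> extensional H" using Z[OF r[OF g]] by (auto simp: configs_def PiE_def)
    show "slice G H (r g) z h = Z (r g) h" if "h \<in> H" for h
      using that g r[OF g] by (simp add: slice_def z_def rr m_assoc[symmetric])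
  qed (simp add: slice_def)
  have "?\<sigma> z = y"
  proof (rule extensionalityI)
    show "?\<sigma> z \<in> extensional (carrier G)" by (simp add: local_ca_def)
    show "y \<in> extensional (carrier G)" using y by (auto simp: configs_def PiE_def)
    fix g assume g: "g \<in> carrier G"
    have "slice G H (r g) (?\<sigma> z) = slice G H (r g) y"
      using slice_local_ca[OF H M r[OF g]] slice_z[OF g] \<tau>Z[OF r[OF g]] by metis
    from fun_cong[OF this, of "inv (r g) \<otimes> g"] show "?\<sigma> z g = y g"
      using rH[OF g] split[OF g] by (simp add: slice_def)
  qed
  moreover have "asymptotic G z x"
    unfolding asymptotic_iff
  proof (rule finite_subset)
    \<comment> \<open>\<open>?T\<close> represents the finitely many cosets met by the perturbation;
      \<open>?D t\<close> is the finite set of changes made by \<open>Z t\<close>, moved back to the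
      coset of \<open>t\<close>.\<close>
    let ?T = "r ` {g \<in> carrier G. y g \<noteq> ?\<sigma> x g}"
    let ?D = "\<lambda>t. (\<lambda>h. t \<otimes> h) ` {h \<in> H. Z t h \<noteq> slice G H t x h}"
    have "finite (?D t)" if "t \<in> ?T" for t
    proof -
      have "t \<in> carrier G" using that r by auto
      from Zx[OF this] show ?thesis by (simp add: asymptotic_iff)
    qed
    with fin show "finite (\<Union>t\<in>?T. ?D t)" by blast
    show "{g \<in> carrier G. z g \<noteq> x g} \<subseteq> (\<Union>t\<in>?T. ?D t)"
    proof
      fix g assume "g \<in> {g \<in> carrier G. z g \<noteq> x g}"
      then have g: "g \<in> carrier G" and ne: "z g \<noteq> x g" by auto
      define h where "h = inv (r g) \<otimes> g"
      have h: "h \<in> H" and rh: "r g \<otimes> h = g" using rH[OF g] split[OF g] by (auto simp: h_def)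
      have Zne: "Z (r g) h \<noteq> slice G H (r g) x h"
        using ne g h rh by (simp add: z_def slice_def flip: h_def)
      \<comment> \<open>By the contrapositive of \<open>Zeq\<close>, a changed coset must contain a
        point where \<open>y\<close> differs from \<open>?\<sigma> x\<close>. That point
        \<open>r g \<otimes> k\<close> may differ from \<open>g\<close> but has the same
        representative.\<close>
      then have "slice G H (r g) y \<noteq> slice G H (r g) (?\<sigma> x)"
        using Zeq[OF r[OF g]] slice_local_ca[OF H M r[OF g]] by metis
      then obtain k where k: "k \<in> H" "y (r g \<otimes> k) \<noteq> ?\<sigma> x (r g \<otimes> k)"
        by (auto simp: slice_def fun_eq_iff split: if_splits)
      then have "r (r g \<otimes> k) \<in> ?T" using r[OF g] by (intro imageI) simp
      then have "r g \<in> ?T" using rr[OF g k(1)] by simp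
      moreover have "g \<in> ?D (r g)" using h rh Zne by (metis (mono_tags, lifting) imageI mem_Collect_eq)
      ultimately show "g \<in> (\<Union>t\<in>?T. ?D t)" by blast
    qed
  qed
  ultimately show "\<exists>z\<in>configs G A. asymptotic G z x \<and> ?\<sigma> z = y" using zc by blast
qed

text \<open>Extensions of \<open>x\<close> and \<open>y\<close> that agree off \<open>H\<close>
  remain asymptotic. Their images agree on \<open>H\<close> by assumption, and off \<open>H\<close>
  because the neighbourhoods of such points miss \<open>H\<close>.\<close>

lemma (in group) pre_injective_of_induced:
  assumes H: "subgroup H G" and M: "M \<subseteq> H"
    and pi: "pre_injective G A (local_ca G M \<mu>)"
  shows "pre_injective (G\<lparr>carrier := H\<rparr>) A (local_ca (G\<lparr>carrier := H\<rparr>) M \<mu>)"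
  unfolding pre_injective_def
proof (intro ballI impI)
  let ?K = "G\<lparr>carrier := H\<rparr>"
  interpret H: subgroup H G by fact
  fix x y assume x: "x \<in> configs ?K A" and y: "y \<in> configs ?K A" and as: "asymptotic ?K x y"
    and eq: "local_ca ?K M \<mu> x = local_ca ?K M \<mu> y"
  have xA: "x h \<in> A" and yA: "y h \<in> A" if "h \<in> H" for h
    using x y that by (auto simp: configs_def)
  \<comment> \<open>The filler \<open>x \<one>\<close> is a letter of \<open>A\<close> at hand,
    since \<open>\<one>\<close> lies in \<open>H\<close>. It is taken from \<open>x\<close> in both
    extensions, so they agree off \<open>H\<close>.\<close>
  define ext where "ext u = (\<lambda>g\<in>carrier G. if g \<in> H then u g else x \<one>)" for u
  have ext: "ext x \<in> configs G A" "ext y \<in> configs G A"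
    using xA yA by (auto simp: ext_def configs_def)
  have "{g \<in> carrier G. ext x g \<noteq> ext y g} \<subseteq> {h \<in> H. x h \<noteq> y h}"
    by (auto simp: ext_def)
  with as have "asymptotic G (ext x) (ext y)"
    by (simp add: asymptotic_iff finite_subset)
  moreover have "local_ca G M \<mu> (ext x) g = local_ca G M \<mu> (ext y) g" for g
  proof -
    consider "g \<in> H" | "g \<in> carrier G" "g \<notin> H" | "g \<notin> carrier G" by blast
    then show ?thesis
    proof cases
      case 1
      then have "(\<lambda>m\<in>M. ext u (g \<otimes> m)) = (\<lambda>m\<in>M. u (g \<otimes> m))" for u
        using M by (auto simp: ext_def fun_eq_iff)
      with 1 fun_cong[OF eq, of g] show ?thesis by (simp add: local_ca_def)
    next
      case 2
      have "g \<otimes> m \<notin> H" if m: "m \<in> H" for m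
      proof
        assume "g \<otimes> m \<in> H"
        then have "g \<otimes> m \<otimes> inv m \<in> H" using m by simp
        with 2 m show False by (simp add: m_assoc)
      qed
      then have "(\<lambda>m\<in>M. ext x (g \<otimes> m)) = (\<lambda>m\<in>M. ext y (g \<otimes> m))"
        using M by (auto simp: ext_def fun_eq_iff)
      then show ?thesis by (simp add: local_ca_def)
    next
      case 3
      then show ?thesis by (simp add: local_ca_def)
    qed
  qed
  ultimately have "ext x = ext y"
    using pi ext unfolding pre_injective_def by blast
  then have "x h = y h" if "h \<in> H" for h
    using that by (auto simp: ext_def dest!: fun_cong[of _ _ h])
  moreover have "x \<in> extensional H" "y \<in> extensional H"
    using x y by (auto simp: configs_def PiE_def)
  ultimately show "x = y" by (rule extensionalityI[rotated 2])
qed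

theorem theorem5p3:
  fixes G :: "('g, 'm) monoid_scheme"
  assumes "group G"
    and "post_injunctive G"
    and "subgroup H G"
  shows "post_injunctive (G\<lparr>carrier := H\<rparr>)"
  unfolding post_injunctive_def
proof (intro allI impI)
  let ?K = "G\<lparr>carrier := H\<rparr>"
  interpret group G by fact
  have K: "group ?K" using assms(3) subgroup.subgroup_is_group is_group by blast
  fix A :: "nat set" and \<tau>
  assume fin: "finite A" and ca: "cellular_automaton ?K A \<tau>" and ps: "post_surjective ?K A \<tau>"
  obtain M \<mu> where M: "finite M" "M \<subseteq> H" and \<mu>: "\<mu> \<in> (M \<rightarrow>\<^sub>E A) \<rightarrow> A"
    and \<tau>: "\<And>x. x \<in> configs ?K A \<Longrightarrow> \<tau> x = local_ca ?K M \<mu> x"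
    using ca unfolding cellular_automaton_iff_local_ca[OF K] by auto
  \<comment> \<open>\<open>\<tau>\<close> is known to equal \<open>local_ca ?K M \<mu>\<close> only
    on configurations, and post-surjectivity evaluates it nowhere else.\<close>
  have "post_surjective ?K A (local_ca ?K M \<mu>)"
    using ps \<tau> unfolding post_surjective_def by metis
  then have "post_surjective G A (local_ca G M \<mu>)"
    using post_surjective_induced[OF assms(3) M(2) \<mu>] by blast
  moreover have "cellular_automaton G A (local_ca G M \<mu>)"
    unfolding cellular_automaton_iff_local_ca[OF is_group]
    using M \<mu> subgroup.subset[OF assms(3)] by blast
  ultimately have "pre_injective G A (local_ca G M \<mu>)"
    using assms(2) fin unfolding post_injunctive_def by blast
  then have "pre_injective ?K A (local_ca ?K M \<mu>)"
    by (rule pre_injective_of_induced[OF assms(3) M(2)])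
  then show "pre_injective ?K A \<tau>"
    using \<tau> unfolding pre_injective_def by simp
qed

end
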